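(* Let $p,q\ge1$ be integers and let $A\in\mathrm{Aut}(D_{p,q})$. (1) If $A$ has at least $p+1$ fixed points in $D_{p,q}$, then there exists a projective line in $\mathbb P^{p+q-1}$ intersecting $D_{p,q}$ on which every point is fixed by $A$. In particular, if an element of $\mathrm{Aut}(D_{p,q})$ has only a finite number of fixed points in $D_{p,q}$, then it has at most $p$ fixed points in $D_{p,q}$. (2) If $A$ has at least $2p+1$ fixed points in $\partial D_{p,q}$, then there exists a projective line in $\mathbb P^{p+q-1}$ on which every point is fixed by $A$.
   Context: $H_{p,q}=\begin{pmatrix}I_p&0\\0&-I_q\end{pmatrix}$ and $\cdot^H$ is the Hermitian (conjugate) transpose. The generalized ball is $D_{p,q}=\{[z]\in\mathbb P^{p+q-1}: z^HH_{p,q}z>0\}$, with boundary $\partial D_{p,q}=\{[z]: z^HH_{p,q}z=0\}$. $\mathrm{Aut}(D_{p,q})$ is the group of biholomorphic automorphisms of $D_{p,q}$. It is known that every automorphism of $D_{p,q}$ is the restriction of a projective linear automorphism $[z]\mapsto[Az]$ of $\mathbb P^{p+q-1}$ with $A\in U(p,q)=\{A\in GL(p+q,\mathbb C):A^HH_{p,q}A=H_{p,q}\}$; the automorphism is also regarded as this map of $\mathbb P^{p+q-1}$, and fixed points on $\partial D_{p,q}$ or elsewhere in $\mathbb P^{p+q-1}$ are understood for it. *)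

theory Defs
  imports "HOL-Analysis.Analysis"
begin

text \<open>
  Points of the projective space of \<^typ>\<open>complex^'n\<close> are its one-dimensional complex subspaces;
  the class \<open>[z]\<close> of \<open>z \<noteq> 0\<close> is \<open>vec.span {z}\<close>.
\<close>

definition projective_space :: "(complex^'n) set set" where
  "projective_space = {L. vec.subspace L \<and> vec.dim L = 1}"

definition projective_lines :: "(complex^'n) set set set" where
  "projective_lines = {{L \<in> projective_space. L \<subseteq> W} | W. vec.subspace W \<and> vec.dim W = 2}"

definition projective_map :: "complex^'n^'n \<Rightarrow> (complex^'n) set \<Rightarrow> (complex^'n) set" where
  "projective_map A L = (\<lambda>z. A *v z) ` L"


subsection \<open>Holomorphic maps between subsets of projective space\<close>

text \<open>
  A complex Frechet derivative: a real derivative that is complex linear. The derivative is taken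
  within \<open>S\<close> because the images of the affine charts below lie in affine hyperplanes.
\<close>

definition complex_differentiable_on ::
  "(complex^'n \<Rightarrow> complex^'m) \<Rightarrow> (complex^'n) set \<Rightarrow> bool" where
  "complex_differentiable_on g S \<longleftrightarrow>
     (\<forall>x\<in>S. \<exists>g'. (g has_derivative g') (at x within S) \<and> (\<forall>c v. g' (c *s v) = c *s g' v))"

definition chart_domain :: "'n \<Rightarrow> (complex^'n) set set" where
  "chart_domain k = {L \<in> projective_space. \<exists>z\<in>L. z $ k \<noteq> 0}"

text \<open>
  The coordinates \<open>(z\<^sub>i / z\<^sub>k)\<^sub>i\<close> of \<open>[z]\<close> in the \<open>k\<close>-th affine chart. The constant coordinate
  \<open>z\<^sub>k / z\<^sub>k = 1\<close> is kept, so the model space of the chart is the hyperplane \<open>{w. w $ k = 1}\<close>, and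
  the inverse of the chart is \<open>w \<mapsto> vec.span {w}\<close>.
\<close>

definition affine_chart :: "'n \<Rightarrow> (complex^'n) set \<Rightarrow> complex^'n" where
  "affine_chart k L = (THE w. w \<in> L \<and> w $ k = 1)"

definition projective_holomorphic_on ::
  "((complex^'n) set \<Rightarrow> (complex^'m) set) \<Rightarrow> (complex^'n) set set \<Rightarrow> bool" where
  "projective_holomorphic_on f D \<longleftrightarrow>
     (\<forall>L\<in>D. \<forall>k l. L \<in> chart_domain k \<and> f L \<in> chart_domain l \<longrightarrow>
        (\<exists>V. open V \<and> affine_chart k L \<in> V \<and>
             (\<forall>w \<in> V \<inter> {w. w $ k = 1}. vec.span {w} \<in> D \<and> f (vec.span {w}) \<in> chart_domain l) \<and>
             complex_differentiable_on (\<lambda>w. affine_chart l (f (vec.span {w})))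
               (V \<inter> {w. w $ k = 1})))"

text \<open>Only the values of an automorphism on \<open>D\<close> are relevant.\<close>

definition biholomorphic_automorphisms ::
  "(complex^'n) set set \<Rightarrow> ((complex^'n) set \<Rightarrow> (complex^'n) set) set" where
  "biholomorphic_automorphisms D =
     {f. bij_betw f D D \<and> projective_holomorphic_on f D \<and>
         projective_holomorphic_on (inv_into D f) D}"


subsection \<open>Generalized balls\<close>

text \<open>
  Coordinates are indexed by \<^typ>\<open>'p + 'q\<close>, with \<open>p = CARD('p)\<close> and \<open>q = CARD('q)\<close>; both are
  automatically at least 1.
\<close>

definition hermitian_transpose :: "complex^'n^'m \<Rightarrow> complex^'m^'n" where
  "hermitian_transpose A = (\<chi> i j. cnj (A $ j $ i))"

definition signature_matrix :: "complex^('p::finite + 'q::finite)^('p + 'q)" where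
  "signature_matrix = (\<chi> i j. if i = j then (case i of Inl _ \<Rightarrow> 1 | Inr _ \<Rightarrow> - 1) else 0)"

text \<open>The number \<open>z\<^sup>H H z\<close>; it is always real.\<close>

definition signature_form :: "complex^('p::finite + 'q::finite) \<Rightarrow> complex" where
  "signature_form z = (\<Sum>i\<in>UNIV. cnj (z $ i) * (signature_matrix *v z) $ i)"

definition generalized_ball :: "(complex^('p::finite + 'q::finite)) set set" where
  "generalized_ball = {vec.span {z} | z. z \<noteq> 0 \<and> Re (signature_form z) > 0}"

definition generalized_ball_boundary :: "(complex^('p::finite + 'q::finite)) set set" where
  "generalized_ball_boundary = {vec.span {z} | z. z \<noteq> 0 \<and> signature_form z = 0}"

definition indefinite_unitary_group :: "(complex^('p::finite + 'q::finite)^('p + 'q)) set" where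
  "indefinite_unitary_group =
     {A. invertible A \<and> hermitian_transpose A ** signature_matrix ** A = signature_matrix}"

text \<open>
  \<open>linear_extension A f\<close>: the automorphism \<open>f\<close> of the generalized ball is the restriction of the
  projective linear map \<open>[z] \<mapsto> [Az]\<close> with \<open>A \<in> U(p,q)\<close>. By a known theorem (not proved here) every automorphism has such an extension,
  and \<open>A\<close> is unique up to a scalar factor, so \<open>projective_map A\<close> is the map of the whole projective
  space with which \<open>f\<close> is identified.
\<close>

definition linear_extension ::
  "complex^('p::finite + 'q::finite)^('p + 'q) \<Rightarrow>
   ((complex^('p + 'q)) set \<Rightarrow> (complex^('p + 'q)) set) \<Rightarrow> bool" where
  "linear_extension A f \<longleftrightarrow>
     A \<in> indefinite_unitary_group \<and> (\<forall>L\<in>generalized_ball. f L = projective_map A L)"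

end

theory Submission
  imports Defs
begin

text \<open>
  Write \<open>h\<close> for the sesquilinear form of signature \<open>(p, q)\<close>. Fixed points of \<open>[z] \<mapsto> [Az]\<close> are the lines
  spanned by eigenvectors, and two distinct fixed points with the same eigenvalue span a projective
  line of fixed points. Otherwise the eigenvalues are distinct, so the eigenvectors are linearly
  independent. Invariance of \<open>h\<close> gives \<open>h x y = 0\<close> for eigenvectors with eigenvalues \<open>a\<close>, \<open>b\<close> unless
  \<open>cnj a * b = 1\<close>. Positive eigenvectors have unimodular eigenvalues and are hence pairwise orthogonal.
  Among \<open>2p + 1\<close> null eigenvectors, at least \<open>p + 1\<close> have eigenvalues in the closed unit disc or at
  least \<open>p + 1\<close> have eigenvalues outside the open one, and each of these two families is pairwise
  orthogonal. An independent orthogonal family on which \<open>h\<close> is nonnegative spans a subspace meeting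
  the negative definite \<open>q\<close>-dimensional coordinate subspace trivially, so it has at most \<open>p\<close> members.
\<close>

section \<open>The sesquilinear form and its invariance\<close>

definition signature_sesquilinear ::
  "complex^('p::finite + 'q::finite) \<Rightarrow> complex^('p + 'q) \<Rightarrow> complex" where
  "signature_sesquilinear x y = (\<Sum>i\<in>UNIV. cnj (x $ i) * (signature_matrix *v y) $ i)"

lemma signature_form_eq: "signature_form z = signature_sesquilinear z z"
  by (simp add: signature_form_def signature_sesquilinear_def)

lemma signature_matrix_mult_nth:
  "(signature_matrix *v y) $ i = (case i of Inl _ \<Rightarrow> y $ i | Inr _ \<Rightarrow> - (y $ i))"
proof -
  have "(signature_matrix *v y) $ i =
      (\<Sum>j\<in>UNIV. if i = j then (case i of Inl _ \<Rightarrow> 1 | Inr _ \<Rightarrow> - 1) * y $ j else 0)"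
    unfolding matrix_vector_mult_def signature_matrix_def vec_lambda_beta
    by (rule sum.cong) auto
  then show ?thesis
    by (simp split: sum.split)
qed

lemma signature_sesquilinear_add_left:
  "signature_sesquilinear (x + y) z = signature_sesquilinear x z + signature_sesquilinear y z"
  by (simp add: signature_sesquilinear_def algebra_simps sum.distrib)

lemma signature_sesquilinear_add_right:
  "signature_sesquilinear x (y + z) = signature_sesquilinear x y + signature_sesquilinear x z"
  by (simp add: signature_sesquilinear_def matrix_vector_right_distrib algebra_simps sum.distrib)

lemma signature_sesquilinear_scale_left:
  "signature_sesquilinear (c *s x) z = cnj c * signature_sesquilinear x z"
  by (simp add: signature_sesquilinear_def sum_distrib_left mult.assoc)

lemma signature_sesquilinear_scale_right:
  "signature_sesquilinear x (c *s z) = c * signature_sesquilinear x z"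
  by (simp add: signature_sesquilinear_def sum_distrib_left vec.scale mult_ac)

lemma signature_sesquilinear_sum_left:
  "signature_sesquilinear (\<Sum>v\<in>B. f v) y = (\<Sum>v\<in>B. signature_sesquilinear (f v) y)"
proof (induction B rule: infinite_finite_induct)
  case empty
  then show ?case by (simp add: signature_sesquilinear_def)
next
  case (insert v B)
  then show ?case by (simp add: signature_sesquilinear_add_left)
qed (simp add: signature_sesquilinear_def)

lemma signature_sesquilinear_sum_right:
  "signature_sesquilinear x (\<Sum>v\<in>B. f v) = (\<Sum>v\<in>B. signature_sesquilinear x (f v))"
proof (induction B rule: infinite_finite_induct)
  case empty
  then show ?case by (simp add: signature_sesquilinear_def)
next
  case (insert v B)
  then show ?case by (simp add: signature_sesquilinear_add_right)
qed (simp add: signature_sesquilinear_def)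

text \<open>Moving \<open>A\<close> out of the left argument turns it into its Hermitian transpose
  (\<open>adj\<close>); the defining equation of the group then removes both factors.\<close>

lemma signature_sesquilinear_preserved:
  assumes "A \<in> indefinite_unitary_group"
  shows "signature_sesquilinear (A *v x) (A *v y) = signature_sesquilinear x y"
proof -
  have adj: "(\<Sum>i\<in>UNIV. cnj ((A *v x) $ i) * w $ i) =
      (\<Sum>k\<in>UNIV. cnj (x $ k) * (hermitian_transpose A *v w) $ k)" for w
  proof -
    have "(\<Sum>i\<in>UNIV. cnj ((A *v x) $ i) * w $ i) =
        (\<Sum>i\<in>UNIV. \<Sum>k\<in>UNIV. cnj (A $ i $ k) * cnj (x $ k) * w $ i)"
      by (simp add: matrix_vector_mult_def sum_distrib_right)
    also have "\<dots> = (\<Sum>k\<in>UNIV. \<Sum>i\<in>UNIV. cnj (A $ i $ k) * cnj (x $ k) * w $ i)"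
      by (rule sum.swap)
    also have "\<dots> = (\<Sum>k\<in>UNIV. cnj (x $ k) * (hermitian_transpose A *v w) $ k)"
      by (simp add: matrix_vector_mult_def hermitian_transpose_def sum_distrib_left mult_ac)
    finally show ?thesis .
  qed
  have "hermitian_transpose A ** signature_matrix ** A = signature_matrix"
    using assms by (simp add: indefinite_unitary_group_def)
  then have "hermitian_transpose A *v (signature_matrix *v (A *v y)) = signature_matrix *v y"
    by (simp add: matrix_vector_mul_assoc matrix_mul_assoc)
  then show ?thesis
    by (simp add: signature_sesquilinear_def adj)
qed

text \<open>By invariance the value at \<open>x\<close>, \<open>y\<close> equals
  \<open>cnj a * b\<close> times itself. With \<open>x = y\<close> this forces a unimodular
  eigenvalue.\<close>

lemma signature_sesquilinear_eigenvectors: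
  assumes "A \<in> indefinite_unitary_group" "A *v x = a *s x" "A *v y = b *s y"
    and "signature_sesquilinear x y \<noteq> 0"
  shows "cnj a * b = 1"
proof -
  have "cnj a * b * signature_sesquilinear x y = signature_sesquilinear (A *v x) (A *v y)"
    by (simp add: assms(2,3) signature_sesquilinear_scale_left signature_sesquilinear_scale_right)
  then show ?thesis
    using assms(4) by (simp add: signature_sesquilinear_preserved[OF assms(1)])
qed

section \<open>Orthogonal families and independent eigenvectors\<close>

lemma Re_signature_sesquilinear_neg:
  fixes x :: "complex^('p::finite + 'q::finite)"
  assumes "\<And>i. x $ Inl i = 0" "x \<noteq> 0"
  shows "Re (signature_sesquilinear x x) < 0"
proof -
  have summand: "Re (cnj (x $ i) * (signature_matrix *v x) $ i) = - (cmod (x $ i))\<^sup>2" for i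
    by (cases i) (simp_all add: assms(1) signature_matrix_mult_nth cmod_power2, simp add: power2_eq_square)
  obtain i where "x $ i \<noteq> 0"
    using assms(2) by (auto simp: vec_eq_iff)
  then have "0 < (\<Sum>i\<in>UNIV. (cmod (x $ i))\<^sup>2)"
    by (intro sum_pos2[of _ i]) auto
  then show ?thesis
    by (simp add: signature_sesquilinear_def summand sum_negf del: times_complex.sel)
qed

text \<open>Orthogonality makes the form nonnegative on all of \<open>vec.span B\<close>, while it
  is negative definite on the kernel of the projection to the first p coordinates. The projection is
  therefore injective on the span and carries \<open>B\<close> to an independent set in a space of
  dimension p. Nonnegativity admits null vectors, as the boundary case requires.\<close>

lemma independent_orthogonal_nonneg_card:
  fixes B :: "(complex^('p::finite + 'q::finite)) set"
  assumes ind: "vec.independent B"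
    and nonneg: "\<And>b. b \<in> B \<Longrightarrow> Re (signature_sesquilinear b b) \<ge> 0"
    and orth: "\<And>a b. a \<in> B \<Longrightarrow> b \<in> B \<Longrightarrow> a \<noteq> b \<Longrightarrow> signature_sesquilinear a b = 0"
  shows "card B \<le> CARD('p)"
proof -
  define P :: "complex^('p + 'q)^'p" where "P = (\<chi> i j. if j = Inl i then 1 else 0)"
  have P_nth: "(P *v x) $ i = x $ Inl i" for x i
    by (simp add: P_def matrix_vector_mult_def if_distrib[of "\<lambda>c. c * _"] cong: if_cong)
  have fin: "finite B"
    using ind by (rule vec.finiteI_independent)
  have "x = 0" if "x \<in> vec.span B" "P *v x = 0" for x
  proof (rule ccontr)
    assume "x \<noteq> 0"
    obtain u where x: "x = (\<Sum>v\<in>B. u v *s v)"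
      using \<open>x \<in> vec.span B\<close> by (auto simp: vec.span_finite[OF fin])
    have "signature_sesquilinear x x =
        (\<Sum>v\<in>B. \<Sum>w\<in>B. cnj (u v) * (u w * signature_sesquilinear v w))"
      unfolding x signature_sesquilinear_sum_left
      by (simp add: signature_sesquilinear_sum_right signature_sesquilinear_scale_left
          signature_sesquilinear_scale_right sum_distrib_left mult.left_commute)
    \<comment> \<open>Orthogonality kills the off-diagonal terms of the double sum.\<close>
    also have "\<dots> = (\<Sum>v\<in>B. cnj (u v) * (u v * signature_sesquilinear v v))"
    proof (rule sum.cong[OF refl])
      fix v assume "v \<in> B"
      then show "(\<Sum>w\<in>B. cnj (u v) * (u w * signature_sesquilinear v w)) =
          cnj (u v) * (u v * signature_sesquilinear v v)"
        using orth[OF \<open>v \<in> B\<close>] by (subst sum.remove[OF fin \<open>v \<in> B\<close>]) (force intro!: sum.neutral)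
    qed
    also have "\<dots> = (\<Sum>v\<in>B. of_real ((cmod (u v))\<^sup>2) * signature_sesquilinear v v)"
      by (simp only: complex_norm_square mult_ac)
    finally have "Re (signature_sesquilinear x x) =
        (\<Sum>v\<in>B. (cmod (u v))\<^sup>2 * Re (signature_sesquilinear v v))"
      by simp
    also have "\<dots> \<ge> 0"
      by (intro sum_nonneg mult_nonneg_nonneg nonneg) auto
    finally have "Re (signature_sesquilinear x x) \<ge> 0" .
    moreover have "x $ Inl i = 0" for i
      using that(2) P_nth[of x i] by simp
    ultimately show False
      using Re_signature_sesquilinear_neg[of x] \<open>x \<noteq> 0\<close> by fastforce
  qed
  then have inj: "inj_on ((*v) P) (vec.span B)"
    by (subst vec.linear_inj_on_iff_eq_0) auto
  then have "vec.independent ((*v) P ` B)"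
    by (intro vec.linear_independent_injective_image ind) auto
  then have "card ((*v) P ` B) \<le> vec.dim (UNIV :: (complex^'p) set)"
    by (intro vec.independent_card_le_dim) auto
  moreover have "card ((*v) P ` B) = card B"
    by (rule card_image, rule inj_on_subset[OF inj vec.span_superset])
  ultimately show ?thesis
    by (simp only: vec_dim_card)
qed

text \<open>If a new eigenvector \<open>b\<close> were a combination of the old ones, computing
  \<open>A *v b\<close> in two ways would give a relation with coefficients
  \<open>u v * (lam v - lam b)\<close>. Independence and distinct eigenvalues make every
  \<open>u v\<close> vanish, so \<open>b = 0\<close>.\<close>

lemma eigenvectors_independent:
  fixes A :: "'a::field^'n^'n"
  assumes "finite B" "inj_on lam B"
    and "\<And>b. b \<in> B \<Longrightarrow> b \<noteq> 0" "\<And>b. b \<in> B \<Longrightarrow> A *v b = lam b *s b"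
  shows "vec.independent B"
  using assms
proof (induction B rule: finite_induct)
  case empty
  then show ?case by (simp add: vec.independent_empty)
next
  case (insert b B)
  have ind: "vec.independent B"
    using insert by (auto simp: inj_on_def)
  have "b \<notin> vec.span B"
  proof
    assume "b \<in> vec.span B"
    then obtain u where b: "b = (\<Sum>v\<in>B. u v *s v)"
      by (auto simp: vec.span_finite[OF insert.hyps(1)])
    have "A *v b = (\<Sum>v\<in>B. (u v * lam v) *s v)"
      unfolding b using insert.prems(3) by (simp add: vec.sum vec.scale)
    moreover have "A *v b = (\<Sum>v\<in>B. (u v * lam b) *s v)"
    proof -
      have "A *v b = lam b *s b"
        using insert.prems(3) by simp
      \<comment> \<open>Unfolding \<open>b\<close> would also rewrite the argument of
        \<open>lam\<close>, so only the vector is replaced.\<close>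
      also have "\<dots> = lam b *s (\<Sum>v\<in>B. u v *s v)"
        by (rule arg_cong[OF b])
      finally show ?thesis
        by (simp add: vec.scale_sum_right mult.commute)
    qed
    ultimately have "(\<Sum>v\<in>B. (u v * (lam v - lam b)) *s v) = 0"
      by (simp add: algebra_simps vec.scale_left_diff_distrib sum_subtractf)
    then have "u v * (lam v - lam b) = 0" if "v \<in> B" for v
      using ind that unfolding vec.dependent_finite[OF insert.hyps(1)]
      by (auto dest!: spec[of _ "\<lambda>v. u v * (lam v - lam b)"])
    moreover have "lam v \<noteq> lam b" if "v \<in> B" for v
      using insert.prems(1) insert.hyps(2) that by (auto simp: inj_on_def)
    ultimately have "b = 0"
      unfolding b by (intro sum.neutral) auto
    then show False
      using insert.prems(2) by auto
  qed
  then show ?case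
    using ind by (rule vec.independent_insertI)
qed

section \<open>Fixed points, eigenvectors and lines of fixed points\<close>

lemma span_singleton_in_projective_space:
  "z \<noteq> 0 \<Longrightarrow> vec.span {z} \<in> projective_space"
  by (simp add: projective_space_def vec.subspace_span)

lemma span_singleton_eqI:
  fixes z w :: "'a::field^'n"
  assumes "z \<noteq> 0" "z \<in> vec.span {w}"
  shows "vec.span {z} = vec.span {w}"
proof -
  obtain c where c: "z = c *s w"
    using assms(2) by (auto simp: vec.span_singleton)
  then have "w = inverse c *s z"
    using assms(1) by auto
  then have "w \<in> vec.span {z}"
    by (metis vec.span_base vec.span_scale insertI1)
  then show ?thesis
    using assms(2) by (intro antisym vec.span_minimal vec.subspace_span) auto
qed

lemma projective_map_span_eigenvector:
  assumes "projective_map A (vec.span {z}) = vec.span {z}"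
  obtains c where "A *v z = c *s z"
proof -
  have "A *v z \<in> vec.span {z}"
    using assms vec.span_base[of z "{z}"] by (auto simp: projective_map_def)
  then show ?thesis
    using that by (auto simp: vec.span_singleton)
qed

text \<open>On the span of \<open>z\<close> and \<open>w\<close> the matrix acts as the scalar
  \<open>c\<close>. Invertibility gives a nonzero \<open>c\<close>, so that \<open>L\<close> is
  mapped onto itself and not collapsed to zero.\<close>

lemma eigenspace_line_fixed:
  assumes inv: "invertible A" and z: "A *v z = c *s z" and w: "A *v w = c *s w"
    and nz: "z \<noteq> 0" and L: "L \<in> projective_space" "L \<subseteq> vec.span {z, w}"
  shows "projective_map A L = L"
proof -
  have "c \<noteq> 0"
  proof
    assume "c = 0"
    then have "A *v z = 0"
      by (simp add: z)
    then show False
      using inv nz by (metis invertible_def matrix_vector_mul_assoc matrix_vector_mul_lid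
          matrix_vector_mult_0_right)
  qed
  have "A *v x = c *s x" if "x \<in> vec.span {z, w}" for x
    using that
  proof (induction rule: vec.span_induct)
    case base
    show "vec.subspace {x. A *v x = c *s x}"
      by (auto simp: vec.subspace_def vec.add vec.scale algebra_simps vec.scale_right_distrib)
  qed (use z w in auto)
  then have "projective_map A L = (\<lambda>x. c *s x) ` L"
    using L(2) unfolding projective_map_def by (intro image_cong) auto
  also have "\<dots> = L"
  proof (intro antisym subsetI)
    have sub: "vec.subspace L"
      using L(1) by (simp add: projective_space_def)
    show "x \<in> L" if "x \<in> (\<lambda>x. c *s x) ` L" for x
      using that sub by (auto simp: vec.subspace_scale)
    show "x \<in> (\<lambda>x. c *s x) ` L" if "x \<in> L" for x
      by (rule image_eqI[of _ _ "inverse c *s x"])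
        (use sub that \<open>c \<noteq> 0\<close> in \<open>auto simp: vec.subspace_scale\<close>)
  qed
  finally show ?thesis .
qed

lemma span_pair_in_projective_lines:
  assumes "z \<noteq> 0" "w \<notin> vec.span {z}"
  shows "{L \<in> projective_space. L \<subseteq> vec.span {z, w}} \<in> projective_lines"
proof -
  have "vec.independent {w, z}"
    using assms by (intro vec.independent_insertI vec.independent_empty) auto
  moreover have "w \<noteq> z"
    using assms(2) vec.span_base[of z "{z}"] by auto
  ultimately have "vec.dim {z, w} = 2"
    by (subst vec.dim_eq_card_independent) (auto simp: insert_commute)
  then show ?thesis
    unfolding projective_lines_def
    by (intro CollectI exI[of _ "vec.span {z, w}"]) (simp add: vec.subspace_span)
qed

text \<open>Each fixed point gets one representing eigenvector; two with a common eigenvalue would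
  span a line of fixed points. \<open>P\<close> stands for positive or null. \<open>no_line\<close>
  concerns only lines through a point of \<open>S\<close>, because for the ball only lines that meet
  it are excluded.\<close>

lemma fixed_points_eigenvectors:
  assumes inv: "invertible A"
    and S: "\<And>L. L \<in> S \<Longrightarrow> projective_map A L = L"
      "\<And>L. L \<in> S \<Longrightarrow> \<exists>z. L = vec.span {z} \<and> z \<noteq> 0 \<and> P z"
    and no_line: "\<And>M L. M \<in> projective_lines \<Longrightarrow> L \<in> S \<Longrightarrow> L \<in> M \<Longrightarrow>
      \<exists>K\<in>M. projective_map A K \<noteq> K"
  shows "\<exists>B lam. card B = card S \<and> inj_on lam B \<and>
    (\<forall>b\<in>B. b \<noteq> 0 \<and> P b \<and> A *v b = lam b *s b)"
proof -
  obtain r where r: "\<And>L. L \<in> S \<Longrightarrow> L = vec.span {r L} \<and> r L \<noteq> 0 \<and> P (r L)"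
    using S(2) by metis
  have "\<exists>c. A *v r L = c *s r L" if "L \<in> S" for L
    using projective_map_span_eigenvector[of A "r L"] S(1)[OF that] r[OF that] by metis
  then have "\<exists>c. A *v b = c *s b" if "b \<in> r ` S" for b
    using that by auto
  then obtain lam where lam: "\<And>b. b \<in> r ` S \<Longrightarrow> A *v b = lam b *s b"
    by metis
  have eq: "K = L" if KL: "K \<in> S" "L \<in> S" "lam (r K) = lam (r L)" for K L
  proof (rule ccontr)
    assume "K \<noteq> L"
    define M where "M = {N \<in> projective_space. N \<subseteq> vec.span {r K, r L}}"
    have "r L \<notin> vec.span {r K}"
      using span_singleton_eqI[of "r L" "r K"] r KL \<open>K \<noteq> L\<close> by metis
    then have "M \<in> projective_lines"
      unfolding M_def using r KL by (intro span_pair_in_projective_lines) auto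
    moreover have "vec.span {r K} \<in> M"
      unfolding M_def using r[OF KL(1)]
      by (intro CollectI conjI span_singleton_in_projective_space vec.span_mono) auto
    then have "K \<in> M"
      using r[OF KL(1)] by simp
    ultimately obtain N where "N \<in> M" "projective_map A N \<noteq> N"
      using no_line KL(1) by blast
    moreover have "A *v r K = lam (r L) *s r K" "A *v r L = lam (r L) *s r L"
      using lam[of "r K"] lam[of "r L"] KL by auto
    ultimately show False
      using eigenspace_line_fixed[OF inv] r[OF KL(1)] unfolding M_def by blast
  qed
  show ?thesis
  proof (intro exI conjI ballI)
    \<comment> \<open>Equal representatives have equal eigenvalues, so \<open>eq\<close> also shows
      that \<open>r\<close> is injective.\<close>
    show "card (r ` S) = card S"
      by (rule card_image) (rule inj_onI, rule eq, auto)
    show "inj_on lam (r ` S)"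
      using eq by (auto intro!: inj_onI)
  qed (use r lam in auto)
qed

section \<open>Fixed points in the ball\<close>

lemma positive_fixed_points_line:
  fixes A :: "complex^('p::finite + 'q::finite)^('p + 'q)"
  assumes A: "A \<in> indefinite_unitary_group"
    and S: "S \<subseteq> {L \<in> generalized_ball. projective_map A L = L}" "card S = CARD('p) + 1"
  shows "\<exists>M \<in> projective_lines. M \<inter> generalized_ball \<noteq> {} \<and> (\<forall>L\<in>M. projective_map A L = L)"
proof (rule ccontr)
  assume no_line: "\<not> ?thesis"
  have "invertible A"
    using A by (simp add: indefinite_unitary_group_def)
  moreover have "projective_map A L = L" if "L \<in> S" for L
    using that S by auto
  moreover have "\<exists>z. L = vec.span {z} \<and> z \<noteq> 0 \<and> Re (signature_form z) > 0" if "L \<in> S" for L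
    using that S by (auto simp: generalized_ball_def)
  moreover have "\<exists>K\<in>M. projective_map A K \<noteq> K" if "M \<in> projective_lines" "L \<in> S" "L \<in> M" for M L
  proof -
    have "L \<in> M \<inter> generalized_ball"
      using that S by auto
    then show ?thesis
      using no_line that(1) by auto
  qed
  ultimately have "\<exists>B lam. card B = card S \<and> inj_on lam B \<and>
      (\<forall>b\<in>B. b \<noteq> 0 \<and> Re (signature_form b) > 0 \<and> A *v b = lam b *s b)"
    by (rule fixed_points_eigenvectors[where P = "\<lambda>z. Re (signature_form z) > 0"])
  then obtain B lam where B: "card B = card S" "inj_on lam B"
    "\<And>b. b \<in> B \<Longrightarrow> b \<noteq> 0 \<and> Re (signature_form b) > 0 \<and> A *v b = lam b *s b"
    by metis
  \<comment> \<open>Infinite sets have cardinality 0, so a positive cardinality implies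
    finiteness.\<close>
  have fin: "finite B"
    using B(1) S(2) by (intro card_ge_0_finite) auto
  have "card B \<le> CARD('p)"
  proof (rule independent_orthogonal_nonneg_card)
    show "vec.independent B"
      using eigenvectors_independent[OF fin B(2)] B(3) by blast
    show "Re (signature_sesquilinear b b) \<ge> 0" if "b \<in> B" for b
      using B(3)[OF that] by (simp add: signature_form_eq)
    show "signature_sesquilinear a b = 0" if "a \<in> B" "b \<in> B" "a \<noteq> b" for a b
    proof (rule ccontr)
      assume "signature_sesquilinear a b \<noteq> 0"
      then have "cnj (lam a) * lam b = 1"
        using signature_sesquilinear_eigenvectors[OF A] B(3) that by blast
      \<comment> \<open>Positivity makes \<open>lam a\<close> unimodular. Then \<open>lam a\<close>
        and \<open>lam b\<close> are both inverse to \<open>cnj (lam a)\<close>, hence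
        equal.\<close>
      moreover have "signature_sesquilinear a a \<noteq> 0"
        using B(3)[OF that(1)] by (auto simp: signature_form_eq)
      then have "cnj (lam a) * lam a = 1"
        using signature_sesquilinear_eigenvectors[OF A] B(3) that by blast
      ultimately have "lam a = lam b"
        by (metis mult_cancel_left mult_zero_left zero_neq_one)
      then show False
        using B(2) that by (auto simp: inj_on_def)
    qed
  qed
  then show False
    using B(1) S(2) by simp
qed

section \<open>Fixed points on the boundary\<close>

text \<open>For a non-orthogonal pair the moduli of the eigenvalues have product 1. As both lie on
  the same closed side of the unit circle, both moduli are 1, and \<open>cnj a * b = 1\<close>
  becomes equality of the eigenvalues, against \<open>inj\<close>.\<close>

lemma null_eigenvectors_card:
  fixes A :: "complex^('p::finite + 'q::finite)^('p + 'q)"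
  assumes A: "A \<in> indefinite_unitary_group" and fin: "finite B" and inj: "inj_on lam B"
    and B: "\<And>b. b \<in> B \<Longrightarrow> b \<noteq> 0 \<and> signature_form b = 0 \<and> A *v b = lam b *s b"
    and outside: "(\<forall>b\<in>B. cmod (lam b) \<ge> 1) \<or> (\<forall>b\<in>B. cmod (lam b) \<le> 1)"
  shows "card B \<le> CARD('p)"
proof (rule independent_orthogonal_nonneg_card)
  show "vec.independent B"
    using eigenvectors_independent[OF fin inj] B by blast
  show "Re (signature_sesquilinear b b) \<ge> 0" if "b \<in> B" for b
    using B[OF that] by (simp add: signature_form_eq)
  show "signature_sesquilinear a b = 0" if "a \<in> B" "b \<in> B" "a \<noteq> b" for a b
  proof (rule ccontr)
    assume "signature_sesquilinear a b \<noteq> 0"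
    then have ab: "cnj (lam a) * lam b = 1"
      using signature_sesquilinear_eigenvectors[OF A] B that by blast
    then have prod: "cmod (lam a) * cmod (lam b) = 1"
      by (metis complex_mod_cnj norm_mult norm_one)
    have "cmod (lam a) = 1"
      using outside
    proof
      assume "\<forall>b\<in>B. cmod (lam b) \<ge> 1"
      then have "cmod (lam a) \<ge> 1" "cmod (lam a) * 1 \<le> cmod (lam a) * cmod (lam b)"
        using that by (blast, intro mult_left_mono) auto
      then show ?thesis
        using prod by simp
    next
      assume "\<forall>b\<in>B. cmod (lam b) \<le> 1"
      then have "cmod (lam a) \<le> 1" "cmod (lam a) * cmod (lam b) \<le> cmod (lam a) * 1"
        using that by (blast, intro mult_left_mono) auto
      then show ?thesis
        using prod by simp
    qed
    then have "cnj (lam a) * lam a = 1"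
      using complex_norm_square[of "lam a"] by (simp add: mult.commute)
    then have "lam a = lam b"
      using ab by (metis mult_cancel_left mult_zero_left zero_neq_one)
    then show False
      using inj that by (auto simp: inj_on_def)
  qed
qed

lemma null_fixed_points_line:
  fixes A :: "complex^('p::finite + 'q::finite)^('p + 'q)"
  assumes A: "A \<in> indefinite_unitary_group"
    and S: "S \<subseteq> {L \<in> generalized_ball_boundary. projective_map A L = L}"
      "card S = 2 * CARD('p) + 1"
  shows "\<exists>M \<in> projective_lines. \<forall>L\<in>M. projective_map A L = L"
proof (rule ccontr)
  assume no_line: "\<not> ?thesis"
  have "invertible A"
    using A by (simp add: indefinite_unitary_group_def)
  moreover have "projective_map A L = L" if "L \<in> S" for L
    using that S by auto
  moreover have "\<exists>z. L = vec.span {z} \<and> z \<noteq> 0 \<and> signature_form z = 0" if "L \<in> S" for L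
    using that S by (auto simp: generalized_ball_boundary_def)
  moreover have "\<exists>K\<in>M. projective_map A K \<noteq> K" if "M \<in> projective_lines" "L \<in> S" "L \<in> M" for M L
    using that(1) no_line by blast
  ultimately have "\<exists>B lam. card B = card S \<and> inj_on lam B \<and>
      (\<forall>b\<in>B. b \<noteq> 0 \<and> signature_form b = 0 \<and> A *v b = lam b *s b)"
    by (rule fixed_points_eigenvectors[where P = "\<lambda>z. signature_form z = 0"])
  then obtain B lam where B: "card B = card S" "inj_on lam B"
    "\<And>b. b \<in> B \<Longrightarrow> b \<noteq> 0 \<and> signature_form b = 0 \<and> A *v b = lam b *s b"
    by metis
  have fin: "finite B"
    using B(1) S(2) by (intro card_ge_0_finite) auto
  \<comment> \<open>The two families overlap on the unit circle, which is harmless: covering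
    \<open>B\<close> by two sets of at most p elements already contradicts
    \<open>2 * CARD('p) + 1\<close>.\<close>
  define B1 where "B1 = {b \<in> B. cmod (lam b) \<ge> 1}"
  define B2 where "B2 = {b \<in> B. cmod (lam b) \<le> 1}"
  have "card C \<le> CARD('p)"
    if "C \<subseteq> B" "(\<forall>b\<in>C. cmod (lam b) \<ge> 1) \<or> (\<forall>b\<in>C. cmod (lam b) \<le> 1)" for C
    using null_eigenvectors_card[OF A finite_subset[OF that(1) fin] inj_on_subset[OF B(2) that(1)]]
      B(3) that by blast
  then have "card B1 \<le> CARD('p)" "card B2 \<le> CARD('p)"
    by (auto simp: B1_def B2_def)
  moreover have "B = B1 \<union> B2"
    by (auto simp: B1_def B2_def)
  then have "card B \<le> card B1 + card B2"
    by (simp add: card_Un_le)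
  ultimately show False
    using B(1) S(2) by simp
qed

section \<open>Lines meeting the ball\<close>

text \<open>Positivity is an open condition, so a line through a point of the ball contains a whole
  real arc of points of the ball. This turns a fixed line into infinitely many fixed points.\<close>

lemma infinite_line_inter_generalized_ball:
  fixes M :: "(complex^('p::finite + 'q::finite)) set set"
  assumes "M \<in> projective_lines" "M \<inter> generalized_ball \<noteq> {}"
  shows "infinite (M \<inter> generalized_ball)"
proof -
  obtain W where W: "vec.subspace W" "vec.dim W = 2"
    and M: "M = {L \<in> projective_space. L \<subseteq> W}"
    using assms(1) by (auto simp: projective_lines_def)
  obtain z where z: "z \<noteq> 0" "Re (signature_form z) > 0" "vec.span {z} \<subseteq> W"
    using assms(2) by (auto simp: M generalized_ball_def)
  have "\<not> W \<subseteq> vec.span {z}"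
    using vec.dim_subset[of W "vec.span {z}"] W z(1) by auto
  then obtain w where w: "w \<in> W" "w \<notin> vec.span {z}"
    by auto
  define p where "p t = z + of_real t *s w" for t :: real
  have notin: "c *s w \<notin> vec.span {z}" if "c \<noteq> 0" for c
    using vec.span_scale[of "c *s w" "{z}" "inverse c"] w that by auto
  have p_nz: "p t \<noteq> 0" for t
  proof
    assume "p t = 0"
    then have "of_real t *s w = - z"
      by (simp add: p_def add_eq_0_iff)
    then have "of_real t *s w \<in> vec.span {z}"
      by (simp add: vec.span_neg vec.span_base)
    then have "t = 0"
      using notin[of "of_real t"] by auto
    then show False
      using \<open>p t = 0\<close> z(1) by (simp add: p_def)
  qed
  \<comment> \<open>From \<open>p s = c *s p t\<close>, comparing the coefficients of the
    independent vectors \<open>z\<close> and \<open>w\<close> gives \<open>c = 1\<close> and then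
    \<open>s = t\<close>.\<close>
  have inj: "inj (\<lambda>t. vec.span {p t})"
  proof (rule injI)
    fix s t assume "vec.span {p s} = vec.span {p t}"
    then have "p s \<in> vec.span {p t}"
      using vec.span_base[of "p s" "{p s}"] by auto
    then obtain c where c: "p s = c *s p t"
      by (auto simp: vec.span_singleton)
    have "(of_real s - c * of_real t) *s w = (c - 1) *s z"
      using c by (simp add: p_def vec.scale_left_diff_distrib vec.scale_right_distrib
          algebra_simps)
    then have "of_real s - c * of_real t = 0"
      using notin by (metis vec.span_base vec.span_scale insertI1)
    moreover from this have "(c - 1) *s z = 0"
      using \<open>_ = (c - 1) *s z\<close> by simp
    then have "c = 1"
      using z(1) by (simp only: vec.scale_eq_0_iff) simp
    ultimately show "s = t"
      by simp
  qed
  \<comment> \<open>Along the arc the form is a quadratic polynomial in \<open>t\<close>, hence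
    continuous.\<close>
  have "signature_form (p t) = signature_sesquilinear z z
      + of_real t * (signature_sesquilinear z w + signature_sesquilinear w z)
      + of_real t * of_real t * signature_sesquilinear w w" for t
    by (simp add: p_def signature_form_eq signature_sesquilinear_add_left
        signature_sesquilinear_add_right signature_sesquilinear_scale_left
        signature_sesquilinear_scale_right algebra_simps)
  then have "isCont (\<lambda>t. Re (signature_form (p t))) 0"
    by simp
  moreover have "Re (signature_form (p 0)) > 0"
    using z by (simp add: p_def)
  ultimately have "\<forall>\<^sub>F t in at 0. Re (signature_form (p t)) > 0"
    by (auto simp: isCont_def intro: order_tendstoD)
  then obtain d where d: "d > 0" "\<And>t. t \<noteq> 0 \<Longrightarrow> \<bar>t\<bar> < d \<Longrightarrow> Re (signature_form (p t)) > 0"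
    by (auto simp: eventually_at)
  \<comment> \<open>The filter \<open>at 0\<close> says nothing about \<open>t = 0\<close>, so an
    open interval to the right of 0 is used.\<close>
  have "(\<lambda>t. vec.span {p t}) ` {0<..<d} \<subseteq> M \<inter> generalized_ball"
  proof (intro image_subsetI IntI)
    fix t assume t: "t \<in> {0<..<d}"
    have "z \<in> W"
      using z(3) vec.span_base[of z "{z}"] by auto
    then have "p t \<in> W"
      using w(1) W(1) by (simp add: p_def vec.subspace_add vec.subspace_scale)
    then show "vec.span {p t} \<in> M"
      using W(1) p_nz by (simp add: M span_singleton_in_projective_space vec.span_minimal)
    show "vec.span {p t} \<in> generalized_ball"
      using d(2)[of t] t p_nz[of t] by (auto simp: generalized_ball_def)
  qed
  moreover have "infinite ((\<lambda>t. vec.span {p t}) ` {0<..<d})"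
    using d(1) by (subst finite_image_iff) (auto intro: inj_on_subset[OF inj])
  ultimately show ?thesis
    using finite_subset by blast
qed

theorem theorem3p9:
  fixes f :: "(complex^('p::finite + 'q::finite)) set \<Rightarrow> (complex^('p + 'q)) set"
    and A :: "complex^('p + 'q)^('p + 'q)"
  assumes "f \<in> biholomorphic_automorphisms generalized_ball"
    and "linear_extension A f"
  shows "((\<exists>S \<subseteq> {L \<in> generalized_ball. f L = L}. finite S \<and> card S = CARD('p) + 1) \<longrightarrow>
           (\<exists>M \<in> projective_lines. M \<inter> generalized_ball \<noteq> {} \<and> (\<forall>L\<in>M. projective_map A L = L))) \<and>
         (finite {L \<in> generalized_ball. f L = L} \<longrightarrow>
           card {L \<in> generalized_ball. f L = L} \<le> CARD('p)) \<and>
         ((\<exists>S \<subseteq> {L \<in> generalized_ball_boundary. projective_map A L = L}.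
             finite S \<and> card S = 2 * CARD('p) + 1) \<longrightarrow>
           (\<exists>M \<in> projective_lines. \<forall>L\<in>M. projective_map A L = L))"
proof -
  have A: "A \<in> indefinite_unitary_group"
    and f: "\<And>L. L \<in> generalized_ball \<Longrightarrow> f L = projective_map A L"
    using assms(2) by (auto simp: linear_extension_def)
  have fixed: "{L \<in> generalized_ball. f L = L} = {L \<in> generalized_ball. projective_map A L = L}"
    using f by auto
  have line: "\<exists>M \<in> projective_lines. M \<inter> generalized_ball \<noteq> {} \<and> (\<forall>L\<in>M. projective_map A L = L)"
    if "S \<subseteq> {L \<in> generalized_ball. f L = L}" "card S = CARD('p) + 1" for S
    using positive_fixed_points_line[OF A] that unfolding fixed .
  \<comment> \<open>More than p fixed points would include p + 1 of them, hence a fixed line meeting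
    the ball, whose infinitely many points there are fixed by \<open>f\<close> as well.\<close>
  have few: "card {L \<in> generalized_ball. f L = L} \<le> CARD('p)"
    if fin: "finite {L \<in> generalized_ball. f L = L}"
  proof (rule ccontr)
    assume "\<not> ?thesis"
    then have "CARD('p) + 1 \<le> card {L \<in> generalized_ball. f L = L}"
      by simp
    then obtain S where S: "S \<subseteq> {L \<in> generalized_ball. f L = L}" "card S = CARD('p) + 1"
      by (rule obtain_subset_with_card_n)
    obtain M where M: "M \<in> projective_lines" "M \<inter> generalized_ball \<noteq> {}"
      "\<forall>L\<in>M. projective_map A L = L"
      using line[OF S] by (elim bexE conjE)
    then have sub: "M \<inter> generalized_ball \<subseteq> {L \<in> generalized_ball. f L = L}"
      using f by auto
    show False
      using infinite_line_inter_generalized_ball[OF M(1,2)] finite_subset[OF sub fin] by contradiction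
  qed
  show ?thesis
    by (intro conjI impI; (elim exE conjE)?; rule line few null_fixed_points_line[OF A]; assumption)
qed

end
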